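(* Let $T,D,a\in\mathbb{R}$ with $a^2+D^2\neq0$ and consider the system $\dot x=Tx-y$, $\dot y=Dx-a$ and the section $\Sigma=\{x=0\}$. The following items are true. 1. If $T=0$, then the graph of the left Poincaré half-map $P$ of the system associated to $\Sigma$, if it exists, is included in the bisector of the fourth quadrant. 2. If $T>0$ (resp. $T<0$), then the graph of the left Poincaré half-map $P$ of the system associated to $\Sigma$, if it exists, is located below (resp. above) the bisector of the fourth quadrant except perhaps at the origin.
   Context: Let $T,D,a\in\mathbb{R}$ with $a^2+D^2\neq0$ (standing assumption) and consider the planar linear system $\dot x=Tx-y$, $\dot y=Dx-a$, with Poincaré section $\Sigma=\{(x,y)\in\mathbb{R}^2:x=0\}$. Left Poincaré half-map $P$: for $y_0\geqslant0$ let $\Phi(t;y_0)=(\Phi_1(t;y_0),\Phi_2(t;y_0))$ be the solution with $\Phi(0;y_0)=(0,y_0)$. If there exists $\tau(y_0)>0$ such that $\Phi_1(\tau(y_0);y_0)=0$ and $\Phi_1(t;y_0)<0$ for every $t\in(0,\tau(y_0))$, put $P(y_0)=\Phi_2(\tau(y_0);y_0)\leqslant0$. If $P(0)$ is not defined by this rule, but for every $\varepsilon>0$ there exist $y_0\in(0,\varepsilon)$ and $y_1\in(-\varepsilon,0)$ with $P(y_0)=y_1$, then $P$ is extended continuously by $P(0)=0$. The domain of $P$ is the interval $I\subset[0,+\infty)$ of all $y_0$ where $P$ is so defined; $P$ exists if $I\neq\emptyset$. The graph of $P$ is the curve $y_1=P(y_0)$, $y_0\in I$, in the $(y_0,y_1)$-plane,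 and the bisector of the fourth quadrant is $\{(y_0,y_1):y_1=-y_0,\ y_0\geqslant0\}$. A point $(y_0,y_1)$ with $y_0\geqslant0$ is below (resp. above) the bisector if $y_1<-y_0$ (resp. $y_1>-y_0$). *)

theory Defs
  imports "HOL-Analysis.Analysis"
begin

definition solution :: "real \<Rightarrow> real \<Rightarrow> real \<Rightarrow> real \<Rightarrow> (real \<Rightarrow> real \<times> real) \<Rightarrow> bool" where
  "solution T D a y0 \<Phi> \<longleftrightarrow>
     \<Phi> 0 = (0, y0) \<and>
     (\<forall>t. (\<Phi> has_vector_derivative (T * fst (\<Phi> t) - snd (\<Phi> t), D * fst (\<Phi> t) - a)) (at t))"

text \<open>
  No condition \<open>y1 \<le> 0\<close> is needed: \<open>x\<close> reaches \<open>0\<close> from below at the return time, where \<open>x' = - y1\<close>.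
\<close>
definition left_return :: "real \<Rightarrow> real \<Rightarrow> real \<Rightarrow> real \<Rightarrow> real \<Rightarrow> bool" where
  "left_return T D a y0 y1 \<longleftrightarrow>
     y0 \<ge> 0 \<and>
     (\<exists>\<Phi> \<tau>. solution T D a y0 \<Phi> \<and> \<tau> > 0 \<and> fst (\<Phi> \<tau>) = 0 \<and>
        (\<forall>t\<in>{0<..<\<tau>}. fst (\<Phi> t) < 0) \<and> y1 = snd (\<Phi> \<tau>))"

text \<open>The second disjunct is the continuous extension by \<open>0\<close> at \<open>0\<close>.\<close>
definition left_half_map_rel :: "real \<Rightarrow> real \<Rightarrow> real \<Rightarrow> real \<Rightarrow> real \<Rightarrow> bool" where
  "left_half_map_rel T D a y0 y1 \<longleftrightarrow>
     left_return T D a y0 y1 \<or>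
     (y0 = 0 \<and> y1 = 0 \<and> \<not> (\<exists>z. left_return T D a 0 z) \<and>
      (\<forall>\<epsilon>>0. \<exists>u\<in>{0<..<\<epsilon>}. \<exists>v\<in>{-\<epsilon><..<0}. left_return T D a u v))"

definition left_half_map_domain :: "real \<Rightarrow> real \<Rightarrow> real \<Rightarrow> real set" where
  "left_half_map_domain T D a = {y0. \<exists>y1. left_half_map_rel T D a y0 y1}"

text \<open>Only meaningful on the domain; well-definedness there is \<open>left_half_map_rel_iff\<close> below.\<close>
definition left_half_map :: "real \<Rightarrow> real \<Rightarrow> real \<Rightarrow> real \<Rightarrow> real" where
  "left_half_map T D a y0 = (THE y1. left_half_map_rel T D a y0 y1)"

definition left_half_map_exists :: "real \<Rightarrow> real \<Rightarrow> real \<Rightarrow> bool" where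
  "left_half_map_exists T D a \<longleftrightarrow> left_half_map_domain T D a \<noteq> {}"

definition left_half_map_graph :: "real \<Rightarrow> real \<Rightarrow> real \<Rightarrow> (real \<times> real) set" where
  "left_half_map_graph T D a = (\<lambda>y0. (y0, left_half_map T D a y0)) ` left_half_map_domain T D a"

definition bisector4 :: "(real \<times> real) set" where
  "bisector4 = {(y0, y1). y1 = - y0 \<and> y0 \<ge> 0}"

definition below_bisector4 :: "(real \<times> real) set" where
  "below_bisector4 = {(y0, y1). y0 \<ge> 0 \<and> y1 < - y0}"

definition above_bisector4 :: "(real \<times> real) set" where
  "above_bisector4 = {(y0, y1). y0 \<ge> 0 \<and> y1 > - y0}"

lemma solution_unique:
  assumes "solution T D a y0 \<Phi>" "solution T D a y0 \<Psi>" "t \<ge> 0"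
  shows "\<Phi> t = \<Psi> t"
proof -
  define u where "u = (\<lambda>t. fst (\<Phi> t) - fst (\<Psi> t))"
  define v where "v = (\<lambda>t. snd (\<Phi> t) - snd (\<Psi> t))"
  define C where "C = 2 * \<bar>T\<bar> + 1 + \<bar>D\<bar>"
  define g where "g = (\<lambda>t. ((u t)\<^sup>2 + (v t)\<^sup>2) * exp (- C * t))"
  have comp: "((\<lambda>s. fst (F s)) has_real_derivative (T * fst (F s) - snd (F s))) (at s) \<and>
        ((\<lambda>s. snd (F s)) has_real_derivative (D * fst (F s) - a)) (at s)"
    if "solution T D a y0 F" for F s
  proof -
    have d: "(F has_vector_derivative (T * fst (F s) - snd (F s), D * fst (F s) - a)) (at s)"
      using that by (simp add: solution_def)
    show ?thesis
      using bounded_linear.has_vector_derivative[OF bounded_linear_fst d]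
        bounded_linear.has_vector_derivative[OF bounded_linear_snd d]
      by (simp add: has_real_derivative_iff_has_vector_derivative)
  qed
  have du: "(u has_real_derivative (T * u s - v s)) (at s)" for s
    unfolding u_def v_def
    by (rule DERIV_cong[OF DERIV_diff[OF conjunct1[OF comp[OF assms(1)]] conjunct1[OF comp[OF assms(2)]]]])
      (simp add: algebra_simps)
  have dv: "(v has_real_derivative (D * u s)) (at s)" for s
    unfolding u_def v_def
    by (rule DERIV_cong[OF DERIV_diff[OF conjunct2[OF comp[OF assms(1)]] conjunct2[OF comp[OF assms(2)]]]])
      (simp add: algebra_simps)
  have dg: "(g has_real_derivative
      (2 * T * (u s)\<^sup>2 + 2 * (D - 1) * (u s * v s) - C * ((u s)\<^sup>2 + (v s)\<^sup>2)) * exp (- C * s)) (at s)" for s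
    unfolding g_def
    by (rule derivative_eq_intros du dv refl | simp add: algebra_simps power2_eq_square)+
  have le: "2 * T * (u s)\<^sup>2 + 2 * (D - 1) * (u s * v s) \<le> C * ((u s)\<^sup>2 + (v s)\<^sup>2)" for s
  proof -
    have "2 * T * (u s)\<^sup>2 \<le> 2 * \<bar>T\<bar> * (u s)\<^sup>2"
      by (rule mult_right_mono) auto
    also have "\<dots> \<le> 2 * \<bar>T\<bar> * ((u s)\<^sup>2 + (v s)\<^sup>2)"
      by (rule mult_left_mono) auto
    finally have "2 * T * (u s)\<^sup>2 \<le> 2 * \<bar>T\<bar> * ((u s)\<^sup>2 + (v s)\<^sup>2)" .
    moreover have "2 * (D - 1) * (u s * v s) \<le> (1 + \<bar>D\<bar>) * ((u s)\<^sup>2 + (v s)\<^sup>2)"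
    proof -
      have "2 * (D - 1) * (u s * v s) \<le> \<bar>(D - 1) * (2 * (u s * v s))\<bar>"
        by (simp add: algebra_simps)
      also have "\<dots> = \<bar>D - 1\<bar> * (2 * \<bar>u s\<bar> * \<bar>v s\<bar>)"
        by (simp add: abs_mult)
      also have "\<dots> \<le> (1 + \<bar>D\<bar>) * ((u s)\<^sup>2 + (v s)\<^sup>2)"
        using sum_squares_bound[of "\<bar>u s\<bar>" "\<bar>v s\<bar>"] by (intro mult_mono) auto
      finally show ?thesis .
    qed
    ultimately show ?thesis by (simp add: C_def algebra_simps)
  qed
  have "g t \<le> g 0"
  proof (rule DERIV_nonpos_imp_nonincreasing[OF assms(3)])
    fix s
    show "\<exists>y. (g has_real_derivative y) (at s) \<and> y \<le> 0"
      using dg[of s] le[of s] by (intro exI conjI) (auto simp: mult_le_0_iff)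
  qed
  also have "g 0 = 0"
    using assms by (simp add: g_def u_def v_def solution_def)
  finally have "(u t)\<^sup>2 + (v t)\<^sup>2 \<le> 0"
    by (simp add: g_def mult_le_0_iff)
  then have "u t = 0 \<and> v t = 0"
    by (simp add: sum_power2_le_zero_iff)
  then show ?thesis
    by (simp add: u_def v_def prod_eq_iff)
qed

lemma left_return_unique:
  assumes "left_return T D a y0 y1" "left_return T D a y0 y2"
  shows "y1 = y2"
proof -
  obtain \<Phi> \<tau> where 1: "solution T D a y0 \<Phi>" "\<tau> > 0" "fst (\<Phi> \<tau>) = 0"
      "\<And>t. 0 < t \<Longrightarrow> t < \<tau> \<Longrightarrow> fst (\<Phi> t) < 0" "y1 = snd (\<Phi> \<tau>)"
    using assms(1) unfolding left_return_def by auto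
  obtain \<Psi> \<sigma> where 2: "solution T D a y0 \<Psi>" "\<sigma> > 0" "fst (\<Psi> \<sigma>) = 0"
      "\<And>t. 0 < t \<Longrightarrow> t < \<sigma> \<Longrightarrow> fst (\<Psi> t) < 0" "y2 = snd (\<Psi> \<sigma>)"
    using assms(2) unfolding left_return_def by auto
  have eq: "\<Phi> t = \<Psi> t" if "t \<ge> 0" for t
    using solution_unique 1(1) 2(1) that by blast
  have "\<not> \<tau> < \<sigma>" "\<not> \<sigma> < \<tau>"
    using 1(2,3) 2(2,3) 1(4)[of \<sigma>] 2(4)[of \<tau>] eq[of \<sigma>] eq[of \<tau>] by auto
  then have "\<tau> = \<sigma>" by simp
  then show ?thesis using 1 2 eq[of \<tau>] by simp
qed

lemma left_half_map_rel_unique: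
  "left_half_map_rel T D a y0 y1 \<Longrightarrow> left_half_map_rel T D a y0 y2 \<Longrightarrow> y1 = y2"
  unfolding left_half_map_rel_def using left_return_unique by blast

lemma left_half_map_rel_iff:
  "left_half_map_rel T D a y0 y1 \<longleftrightarrow>
     y0 \<in> left_half_map_domain T D a \<and> left_half_map T D a y0 = y1"
  unfolding left_half_map_domain_def left_half_map_def
  by (auto intro: the_equality left_half_map_rel_unique theI2)

end

theory Submission
  imports Defs
begin

text \<open>
  With \<open>x' = T x - y\<close>, the system is the damped oscillator \<open>x'' = T x' - D x + a\<close>, whose energy
  \<open>G = D x\<^sup>2 - 2 a x + x'\<^sup>2\<close> satisfies \<open>G' = 2 T x'\<^sup>2\<close>. On \<open>x = 0\<close> the energy is \<open>y\<^sup>2\<close>, so the sign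
  of \<open>y1\<^sup>2 - y0\<^sup>2\<close> is the sign of \<open>T\<close>; conclude with \<open>y0 \<ge> 0 \<ge> y1\<close>.
\<close>

text \<open>One point of positive derivative makes a nondecreasing function grow strictly across it.
  This suits the energy, whose derivative \<open>2 * T * (v s)\<^sup>2\<close> may vanish at some
  times.\<close>

lemma DERIV_nonneg_pos_imp_less:
  fixes f f' :: "real \<Rightarrow> real"
  assumes deriv: "\<And>s. (f has_real_derivative f' s) (at s)"
    and nonneg: "\<And>s. f' s \<ge> 0"
    and \<xi>: "a < \<xi>" "\<xi> < b" "f' \<xi> > 0"
  shows "f a < f b"
proof -
  have mono: "f s \<le> f t" if "s \<le> t" for s t
    using DERIV_nonneg_imp_nondecreasing[OF that] deriv nonneg by blast
  obtain d where d: "d > 0" "\<And>h. h > 0 \<Longrightarrow> h < d \<Longrightarrow> f \<xi> < f (\<xi> + h)"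
    using DERIV_pos_inc_right[OF deriv \<xi>(3)] by blast
  \<comment> \<open>Halving \<open>d\<close> gives the strict bound \<open>h < d\<close>; the cap
    \<open>b - \<xi>\<close> keeps \<open>\<xi> + h\<close> at most \<open>b\<close>.\<close>
  define h where "h = min (d / 2) (b - \<xi>)"
  have "f a \<le> f \<xi>"
    using mono \<xi> by simp
  also have "f \<xi> < f (\<xi> + h)"
    using d \<xi> by (simp add: h_def min_def)
  also have "f (\<xi> + h) \<le> f b"
    by (rule mono) (simp add: h_def)
  finally show ?thesis .
qed

lemma solution_has_real_derivative:
  assumes "solution T D a y0 \<Phi>"
  shows "((\<lambda>t. fst (\<Phi> t)) has_real_derivative (T * fst (\<Phi> s) - snd (\<Phi> s))) (at s)"
    and "((\<lambda>t. snd (\<Phi> t)) has_real_derivative (D * fst (\<Phi> s) - a)) (at s)"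
proof -
  have "(\<Phi> has_vector_derivative (T * fst (\<Phi> s) - snd (\<Phi> s), D * fst (\<Phi> s) - a)) (at s)"
    using assms by (simp add: solution_def)
  from bounded_linear.has_vector_derivative[OF bounded_linear_fst this]
    bounded_linear.has_vector_derivative[OF bounded_linear_snd this]
  show "((\<lambda>t. fst (\<Phi> t)) has_real_derivative (T * fst (\<Phi> s) - snd (\<Phi> s))) (at s)"
    and "((\<lambda>t. snd (\<Phi> t)) has_real_derivative (D * fst (\<Phi> s) - a)) (at s)"
    by (simp_all add: has_real_derivative_iff_has_vector_derivative)
qed

text \<open>If \<open>y1 > 0\<close>, then \<open>x' = - y1 < 0\<close> at the return time, so
  \<open>x\<close> would be positive just before it, whereas the orbit arrives from
  \<open>x < 0\<close>.\<close>

lemma left_return_nonpos: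
  assumes "left_return T D a y0 y1"
  shows "y1 \<le> 0"
proof (rule ccontr)
  assume "\<not> y1 \<le> 0"
  obtain \<Phi> \<tau> where \<Phi>: "solution T D a y0 \<Phi>" "\<tau> > 0" "fst (\<Phi> \<tau>) = 0"
      "\<And>t. 0 < t \<Longrightarrow> t < \<tau> \<Longrightarrow> fst (\<Phi> t) < 0" "y1 = snd (\<Phi> \<tau>)"
    using assms unfolding left_return_def by auto
  have "T * fst (\<Phi> \<tau>) - snd (\<Phi> \<tau>) < 0"
    using \<Phi> \<open>\<not> y1 \<le> 0\<close> by simp
  from DERIV_neg_dec_left[OF solution_has_real_derivative(1)[OF \<Phi>(1)] this]
  obtain d where d: "d > 0" "\<And>h. h > 0 \<Longrightarrow> h < d \<Longrightarrow> fst (\<Phi> \<tau>) < fst (\<Phi> (\<tau> - h))"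
    by blast
  define h where "h = min d \<tau> / 2"
  have "h > 0" "h < d" "h < \<tau>"
    using d(1) \<Phi>(2) by (auto simp: h_def min_def)
  then show False
    using d(2)[of h] \<Phi>(3) \<Phi>(4)[of "\<tau> - h"] by simp
qed

lemma left_return_energy:
  assumes "left_return T D a y0 y1"
  shows "T = 0 \<Longrightarrow> y1\<^sup>2 = y0\<^sup>2"
    and "T > 0 \<Longrightarrow> y0\<^sup>2 < y1\<^sup>2"
    and "T < 0 \<Longrightarrow> y1\<^sup>2 < y0\<^sup>2"
proof -
  obtain \<Phi> \<tau> where \<Phi>: "solution T D a y0 \<Phi>" "\<tau> > 0" "fst (\<Phi> \<tau>) = 0"
      "\<And>t. 0 < t \<Longrightarrow> t < \<tau> \<Longrightarrow> fst (\<Phi> t) < 0" "y1 = snd (\<Phi> \<tau>)"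
    using assms unfolding left_return_def by auto
  define x where "x = (\<lambda>t. fst (\<Phi> t))"
  define v where "v = (\<lambda>t. T * fst (\<Phi> t) - snd (\<Phi> t))"
  define G where "G = (\<lambda>t. D * (x t)\<^sup>2 - 2 * a * x t + (v t)\<^sup>2)"
  have dx: "(x has_real_derivative v s) (at s)" for s
    unfolding x_def v_def by (rule solution_has_real_derivative(1)[OF \<Phi>(1)])
  have dv: "(v has_real_derivative (T * v s - (D * x s - a))) (at s)" for s
    unfolding v_def x_def
    by (intro DERIV_diff DERIV_cmult solution_has_real_derivative[OF \<Phi>(1)])
  \<comment> \<open>The terms \<open>2 * (D * x s - a) * v s\<close> from the potential cancel
    against those from \<open>2 * v s * v'\<close>; only the damping term survives.\<close>
  have dG: "(G has_real_derivative (2 * T * (v s)\<^sup>2)) (at s)" for s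
    unfolding G_def
    by (rule derivative_eq_intros dx dv refl | simp add: algebra_simps power2_eq_square)+
  have ends: "G 0 = y0\<^sup>2" "G \<tau> = y1\<^sup>2"
    using \<Phi> by (simp_all add: G_def x_def v_def solution_def)
  have "0 < \<tau> / 2"
    using \<Phi>(2) by simp
  \<comment> \<open>Up to \<open>\<tau> / 2\<close> the coordinate \<open>x\<close> drops from 0 to
    a negative value, so the mean slope is nonzero; over all of \<open>[0, \<tau>]\<close> it would
    be 0.\<close>
  from MVT2[OF this dx] obtain \<xi> where \<xi>: "0 < \<xi>" "\<xi> < \<tau> / 2" "x (\<tau> / 2) - x 0 = (\<tau> / 2 - 0) * v \<xi>"
    by blast
  have "x (\<tau> / 2) < 0" "x 0 = 0"
    using \<Phi>(1,2) \<Phi>(4)[of "\<tau> / 2"] by (simp_all add: x_def solution_def)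
  with \<xi>(3) have "v \<xi> \<noteq> 0"
    by auto
  have "\<xi> < \<tau>"
    using \<xi> by simp
  show "y1\<^sup>2 = y0\<^sup>2" if "T = 0"
    using DERIV_isconst_all[of G \<tau> 0] dG that ends by simp
  show "y0\<^sup>2 < y1\<^sup>2" if "T > 0"
    using DERIV_nonneg_pos_imp_less[OF dG _ \<open>0 < \<xi>\<close> \<open>\<xi> < \<tau>\<close>] that \<open>v \<xi> \<noteq> 0\<close> ends by simp
  \<comment> \<open>For negative damping coefficient \<open>T\<close> it is \<open>- G\<close> that
    is nondecreasing.\<close>
  show "y1\<^sup>2 < y0\<^sup>2" if "T < 0"
    using DERIV_nonneg_pos_imp_less[OF DERIV_minus[OF dG] _ \<open>0 < \<xi>\<close> \<open>\<xi> < \<tau>\<close>] that \<open>v \<xi> \<noteq> 0\<close> ends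
    by (simp add: mult_nonpos_nonneg mult_neg_pos)
qed

text \<open>Both \<open>y0\<close> and \<open>- y1\<close> are nonnegative, so comparing their
  squares compares the numbers themselves.\<close>

lemma left_return_bisector:
  assumes "left_return T D a y0 y1"
  shows "T = 0 \<Longrightarrow> y1 = - y0"
    and "T > 0 \<Longrightarrow> y1 < - y0"
    and "T < 0 \<Longrightarrow> - y0 < y1"
proof -
  have "y0 \<ge> 0" "- y1 \<ge> 0"
    using assms left_return_nonpos[OF assms] by (simp_all add: left_return_def)
  then show "T = 0 \<Longrightarrow> y1 = - y0" "T > 0 \<Longrightarrow> y1 < - y0" "T < 0 \<Longrightarrow> - y0 < y1"
    using left_return_energy[OF assms] power2_less_imp_less[of y0 "- y1"]
      power2_less_imp_less[of "- y1" y0] power2_eq_imp_eq[of "- y1" y0]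
    by force+
qed

text \<open>The continuous extension contributes only the origin, so every other point of the graph
  comes from a genuine return of an orbit.\<close>

lemma left_half_map_graph_cases:
  assumes "p \<in> left_half_map_graph T D a"
  obtains "p = (0, 0)" | y0 y1 where "p = (y0, y1)" "y0 \<ge> 0" "left_return T D a y0 y1"
proof -
  obtain y0 where "y0 \<in> left_half_map_domain T D a" "p = (y0, left_half_map T D a y0)"
    using assms by (auto simp: left_half_map_graph_def)
  then have "left_half_map_rel T D a y0 (left_half_map T D a y0)"
    by (simp add: left_half_map_rel_iff)
  then show thesis
    using that \<open>p = _\<close> unfolding left_half_map_rel_def left_return_def by auto
qed

theorem corollary1:
  fixes T D a :: real
  assumes "a\<^sup>2 + D\<^sup>2 \<noteq> 0"
  shows "(T = 0 \<longrightarrow> left_half_map_exists T D a \<longrightarrow>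
            left_half_map_graph T D a \<subseteq> bisector4) \<and>
         (T > 0 \<longrightarrow> left_half_map_exists T D a \<longrightarrow>
            left_half_map_graph T D a - {(0, 0)} \<subseteq> below_bisector4) \<and>
         (T < 0 \<longrightarrow> left_half_map_exists T D a \<longrightarrow>
            left_half_map_graph T D a - {(0, 0)} \<subseteq> above_bisector4)"
proof (intro conjI impI subsetI)
  fix p
  assume "T = 0" "p \<in> left_half_map_graph T D a"
  \<comment> \<open>The origin needs no exclusion here, since it lies on the bisector.\<close>
  then show "p \<in> bisector4"
    by (auto simp: bisector4_def dest: left_return_bisector(1) elim!: left_half_map_graph_cases)
next
  fix p
  assume "T > 0" "p \<in> left_half_map_graph T D a - {(0, 0)}"
  then show "p \<in> below_bisector4"
    by (auto simp: below_bisector4_def dest: left_return_bisector(2) elim!: left_half_map_graph_cases)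
next
  fix p
  assume "T < 0" "p \<in> left_half_map_graph T D a - {(0, 0)}"
  then show "p \<in> above_bisector4"
    by (auto simp: above_bisector4_def dest: left_return_bisector(3) elim!: left_half_map_graph_cases)
qed

end
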